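(* Let $X$ be a regular curve and let $f:X\to X$ be a homeomorphism with at least one wandering point. Then $h_{\mathrm{pol}}(f)=1$.
   Context: A continuum is a nonempty connected compact metric space. A continuum $X$ is a regular curve if for each $x\in X$ and each open neighbourhood $U$ of $x$ in $X$ there exists an open neighbourhood $V$ of $x$ in $X$ such that $V\subset U$ and the boundary $\partial V$ is finite. Polynomial entropy: let $(X,d)$ be a compact metric space and $f:X\to X$ continuous. For $n\geq 1$ put $d_n^f(x,y)=\max_{0\leq k\leq n-1}d(f^k(x),f^k(y))$. For $\varepsilon>0$, a finite set $E\subset X$ is $(n,\varepsilon)$-separated if $d_n^f(x,y)\geq\varepsilon$ for all distinct $x,y\in E$; $\mathrm{sep}(n,\varepsilon)$ denotes the maximal cardinality of an $(n,\varepsilon)$-separated subset of $X$. Then $$h_{\mathrm{pol}}(f)=\lim_{\varepsilon\to 0}\limsup_{n\to\infty}\frac{\log \mathrm{sep}(n,\varepsilon)}{\log n}.$$ A set $A\subset X$ is wandering (for $f$) if $f^n(A)\cap A=\emptyset$ for all $n\geq 1$. A point $p\in X$ is wandering if it has a wandering neighbourhood $U\ni p$. *)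

theory Defs
  imports "HOL-Analysis.Analysis"
begin

(* A metric space is represented by a set X in a metric space type, with the restricted
   metric; open sets, interiors and boundaries are those of the subspace top_of_set X. *)

definition continuum :: "'a::metric_space set \<Rightarrow> bool" where
  "continuum X \<longleftrightarrow> X \<noteq> {} \<and> connected X \<and> compact X"

definition regular_curve :: "'a::metric_space set \<Rightarrow> bool" where
  "regular_curve X \<longleftrightarrow> continuum X \<and>
     (\<forall>x\<in>X. \<forall>U. openin (top_of_set X) U \<and> x \<in> U \<longrightarrow>
        (\<exists>V. openin (top_of_set X) V \<and> x \<in> V \<and> V \<subseteq> U \<and>
             finite ((top_of_set X) frontier_of V)))"

(* Intended for n \<ge> 1; truncated subtraction makes n = 0 agree with n = 1. *)
definition bowen_dist :: "('a::metric_space \<Rightarrow> 'a) \<Rightarrow> nat \<Rightarrow> 'a \<Rightarrow> 'a \<Rightarrow> real" where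
  "bowen_dist f n x y = Max ((\<lambda>k. dist ((f ^^ k) x) ((f ^^ k) y)) ` {0..n - 1})"

definition separated_set ::
    "'a::metric_space set \<Rightarrow> ('a \<Rightarrow> 'a) \<Rightarrow> nat \<Rightarrow> real \<Rightarrow> 'a set \<Rightarrow> bool" where
  "separated_set X f n \<epsilon> E \<longleftrightarrow> finite E \<and> E \<subseteq> X \<and>
     (\<forall>x\<in>E. \<forall>y\<in>E. x \<noteq> y \<longrightarrow> bowen_dist f n x y \<ge> \<epsilon>)"

(* The maximum exists for n \<ge> 1 and \<epsilon> > 0 if X is compact and f maps X continuously to X. *)
definition sep :: "'a::metric_space set \<Rightarrow> ('a \<Rightarrow> 'a) \<Rightarrow> nat \<Rightarrow> real \<Rightarrow> nat" where
  "sep X f n \<epsilon> = Max {card E | E. separated_set X f n \<epsilon> E}"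

(* Extended real valued, since the entropy may be infinite. For a continuous self-map of a
   nonempty compact X the limit exists, the upper limit being nonincreasing in \<epsilon>. *)
definition polynomial_entropy :: "'a::metric_space set \<Rightarrow> ('a \<Rightarrow> 'a) \<Rightarrow> ereal" where
  "polynomial_entropy X f =
     Lim (at_right 0) (\<lambda>\<epsilon>. limsup (\<lambda>n. ereal (ln (real (sep X f n \<epsilon>)) / ln (real n))))"

definition wandering_set :: "('a \<Rightarrow> 'a) \<Rightarrow> 'a set \<Rightarrow> bool" where
  "wandering_set f A \<longleftrightarrow> (\<forall>n\<ge>1. (f ^^ n) ` A \<inter> A = {})"

definition wandering_point :: "'a::metric_space set \<Rightarrow> ('a \<Rightarrow> 'a) \<Rightarrow> 'a \<Rightarrow> bool" where
  "wandering_point X f p \<longleftrightarrow>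
     (\<exists>U\<subseteq>X. p \<in> (top_of_set X) interior_of U \<and> wandering_set f U)"

end

theory Submission
  imports Defs
begin

text \<open>
  For every sufficiently small \<open>\<epsilon>\<close> the separation numbers lie between \<open>n\<close> and \<open>n * K\<close>, where \<open>K\<close>
  depends on \<open>\<epsilon>\<close> but not on \<open>n\<close>. Since \<open>ln (n * K) / ln n\<close> tends to \<open>1\<close>, the upper limit in the
  definition of the entropy equals \<open>1\<close> for all these \<open>\<epsilon>\<close>.

  Lower bound (\<open>separated_backward_orbit\<close>). Let \<open>p\<close> be a wandering point, \<open>U\<close> a wandering
  neighbourhood of it, and \<open>q k\<close> the point that reaches \<open>p\<close> after \<open>k\<close> steps. For \<open>i < j\<close>, at time \<open>j\<close>
  the orbit of \<open>q j\<close> is at \<open>p\<close>, while that of \<open>q i\<close> passed through \<open>p\<close> earlier and therefore is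
  outside \<open>U\<close>. Hence \<open>q 0, \<dots>, q (n - 1)\<close> are separated at a scale given by \<open>U\<close>.

  Upper bound (\<open>card_separated_set_linear_bound\<close>). Cover the curve by finitely many small open
  sets with finite boundaries, and let \<open>F\<close> consist of these boundaries and one more point, so that
  it is not empty: it cuts the curve into
  small pieces (\<open>regular_curve_cutting_set\<close>). Let \<open>S\<close> be the set of points that hit \<open>F\<close> at some
  time below \<open>n\<close>. As \<open>f\<close> is injective, \<open>S\<close> has at most \<open>n * card F\<close> elements. Moreover \<open>S\<close> comes
  close, in the Bowen distance, to every point of the curve (\<open>hitting_set_spans\<close>): the first \<open>n\<close>
  iterates map a component of the complement of \<open>S\<close> to connected sets missing \<open>F\<close>, that is, to
  small sets, and by boundary bumping the closure of the component meets \<open>S\<close>. The complement of \<open>S\<close>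
  can have infinitely many components, so counting these would not do; it is \<open>S\<close> itself that is
  counted.
\<close>

section \<open>Bowen distances and separated sets\<close>

lemma bowen_dist_ge_iff:
  assumes "n \<ge> 1"
  shows "\<epsilon> \<le> bowen_dist f n x y \<longleftrightarrow> (\<exists>k<n. \<epsilon> \<le> dist ((f ^^ k) x) ((f ^^ k) y))"
proof -
  have "{0..n - 1} = {..<n}"
    using assms by auto
  then show ?thesis
    using assms unfolding bowen_dist_def by (subst Max_ge_iff) (auto simp: lessThan_empty_iff)
qed

lemma separated_set_antimono:
  "\<lbrakk>separated_set X f n \<delta> E; \<epsilon> \<le> \<delta>\<rbrakk> \<Longrightarrow> separated_set X f n \<epsilon> E"
  unfolding separated_set_def by force

text \<open>
  Two points of \<open>E\<close> that follow the same point of \<open>S\<close> are too close to each other to be separated.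
\<close>

lemma card_separated_set_le_spanning:
  assumes n: "n \<ge> 1" and fin: "finite S"
    and span: "\<And>x. x \<in> X \<Longrightarrow> \<exists>z\<in>S. \<forall>k<n. dist ((f ^^ k) x) ((f ^^ k) z) < \<epsilon> / 2"
    and E: "separated_set X f n \<epsilon> E"
  shows "card E \<le> card S"
proof -
  have "\<forall>x\<in>E. \<exists>z\<in>S. \<forall>k<n. dist ((f ^^ k) x) ((f ^^ k) z) < \<epsilon> / 2"
    using span E by (auto simp: separated_set_def)
  then obtain g where g: "\<And>x. x \<in> E \<Longrightarrow> g x \<in> S"
    and close: "\<And>x k. \<lbrakk>x \<in> E; k < n\<rbrakk> \<Longrightarrow> dist ((f ^^ k) x) ((f ^^ k) (g x)) < \<epsilon> / 2"
    by metis
  have "inj_on g E"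
  proof (rule inj_onI, rule ccontr)
    fix x y assume xy: "x \<in> E" "y \<in> E" "g x = g y" "x \<noteq> y"
    then have "\<epsilon> \<le> bowen_dist f n x y"
      using E by (auto simp: separated_set_def)
    then obtain k where k: "k < n" "\<epsilon> \<le> dist ((f ^^ k) x) ((f ^^ k) y)"
      using bowen_dist_ge_iff[OF n] by blast
    have "dist ((f ^^ k) x) ((f ^^ k) y) < \<epsilon>"
      using close[OF xy(1) k(1)] close[OF xy(2) k(1)] xy(3) by (metis dist_triangle_half_r dist_commute)
    with k show False by simp
  qed
  then show ?thesis
    using g fin by (intro card_inj_on_le[of g]) auto
qed

text \<open>
  The bound \<open>b\<close> also serves to make the set of cardinalities finite; without it the maximum that
  defines \<open>sep\<close> could have an unspecified value.
\<close>

lemma sep_bounds: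
  assumes bound: "\<And>E. separated_set X f n \<epsilon> E \<Longrightarrow> card E \<le> b"
  shows sep_le: "sep X f n \<epsilon> \<le> b"
    and card_le_sep: "separated_set X f n \<epsilon> E \<Longrightarrow> card E \<le> sep X f n \<epsilon>"
proof -
  have fin: "finite {card E | E. separated_set X f n \<epsilon> E}"
    by (rule finite_subset[of _ "{..b}"]) (use bound in auto)
  have "separated_set X f n \<epsilon> {}"
    by (simp add: separated_set_def)
  then show "sep X f n \<epsilon> \<le> b"
    unfolding sep_def using fin bound by (subst Max_le_iff) auto
  show "separated_set X f n \<epsilon> E \<Longrightarrow> card E \<le> sep X f n \<epsilon>"
    unfolding sep_def using fin by (intro Max_ge) auto
qed

section \<open>Spanning sets in regular curves\<close>

text \<open>
  A connected set that avoids the boundary of an open set \<open>V\<close> and meets \<open>V\<close> is contained in \<open>V\<close>. So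
  the boundaries of a finite cover by small sets form a cutting set.
\<close>

lemma regular_curve_cutting_set:
  assumes X: "regular_curve X" and "\<epsilon> > 0"
  obtains F where "finite F" "F \<noteq> {}" "F \<subseteq> X"
    "\<forall>C. connected C \<and> C \<subseteq> X \<and> C \<inter> F = {} \<longrightarrow> (\<forall>x\<in>C. \<forall>y\<in>C. dist x y < \<epsilon>)"
proof -
  define cells where
    "cells = {V. openin (top_of_set X) V \<and> finite ((top_of_set X) frontier_of V) \<and>
                 (\<forall>x\<in>V. \<forall>y\<in>V. dist x y < \<epsilon>)}"
  have "compact X" and "X \<noteq> {}"
    using X by (auto simp: regular_curve_def continuum_def)
  then obtain p where p: "p \<in> X" by blast
  have "\<exists>V\<in>cells. x \<in> V" if x: "x \<in> X" for x
  proof -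
    let ?U = "X \<inter> ball x (\<epsilon> / 2)"
    have "openin (top_of_set X) ?U" "x \<in> ?U"
      using x \<open>\<epsilon> > 0\<close> by (auto intro: openin_open_Int)
    then obtain V where V: "openin (top_of_set X) V" "x \<in> V" "V \<subseteq> ?U"
        "finite ((top_of_set X) frontier_of V)"
      using X x unfolding regular_curve_def by meson
    have "dist y z < \<epsilon>" if "y \<in> V" "z \<in> V" for y z
    proof -
      have "dist x y < \<epsilon> / 2" "dist x z < \<epsilon> / 2"
        using that V(3) by auto
      then show ?thesis
        by (rule dist_triangle_half_r)
    qed
    with V show ?thesis
      by (auto simp: cells_def)
  qed
  then have "X \<subseteq> \<Union>cells" by blast
  then obtain D where D: "D \<subseteq> cells" "finite D" "X \<subseteq> \<Union>D"
    using \<open>compact X\<close>[unfolded compact_eq_openin_cover, rule_format, of cells]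
    by (auto simp: cells_def)
  \<comment> \<open>If \<open>X\<close> itself is small, all boundaries may be empty. Boundary bumping needs a point to bump
    into, so \<open>p\<close> is added.\<close>
  define F where "F = insert p (\<Union>V\<in>D. (top_of_set X) frontier_of V)"
  show thesis
  proof
    show "finite F"
      using D by (auto simp: F_def cells_def)
    show "F \<noteq> {}" by (simp add: F_def)
    show "F \<subseteq> X"
      using p frontier_of_subset_topspace[of "top_of_set X"] by (auto simp: F_def)
    show "\<forall>C. connected C \<and> C \<subseteq> X \<and> C \<inter> F = {} \<longrightarrow> (\<forall>x\<in>C. \<forall>y\<in>C. dist x y < \<epsilon>)"
    proof (intro allI impI ballI, elim conjE)
      fix C x y assume C: "connected C" "C \<subseteq> X" "C \<inter> F = {}" "x \<in> C" "y \<in> C"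
      then obtain V where V: "V \<in> D" "x \<in> V"
        using D by blast
      have "connectedin (top_of_set X) C"
        using C by (simp add: connectedin_subtopology)
      moreover have "C \<inter> (top_of_set X) frontier_of V = {}"
        using C V by (auto simp: F_def)
      ultimately have "C \<subseteq> V"
        using connectedin_Int_frontier_of[of "top_of_set X" C V] C V by blast
      moreover have "V \<in> cells"
        using V D by blast
      ultimately show "dist x y < \<epsilon>"
        using C unfolding cells_def by blast
    qed
  qed
qed

text \<open>
  Every point outside \<open>S\<close> is followed by a point of \<open>S\<close> that lies in the closure of its component in
  the complement of \<open>S\<close>. Such a point exists by boundary bumping; estimates on the iterates of the
  component pass to its closure because the iterates are continuous.
\<close>

lemma hitting_set_spans:
  assumes X: "continuum X"
    and cont: "\<And>k. k < n \<Longrightarrow> continuous_map (top_of_set X) (top_of_set X) (f ^^ k)"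
    and F: "\<And>C x y. \<lbrakk>connected C; C \<subseteq> X; C \<inter> F = {}; x \<in> C; y \<in> C\<rbrakk> \<Longrightarrow> dist x y \<le> \<epsilon>"
    and "\<epsilon> \<ge> 0" and S: "finite S" "S \<noteq> {}" "S \<subseteq> X"
    and hits: "\<And>x k. \<lbrakk>x \<in> X; k < n; (f ^^ k) x \<in> F\<rbrakk> \<Longrightarrow> x \<in> S"
    and x: "x \<in> X"
  shows "\<exists>z\<in>S. \<forall>k<n. dist ((f ^^ k) x) ((f ^^ k) z) \<le> \<epsilon>"
proof (cases "x \<in> S")
  case True
  with \<open>\<epsilon> \<ge> 0\<close> show ?thesis by (intro bexI[of _ x]) auto
next
  case False
  let ?T = "top_of_set X"
  define C where "C = connected_component_of_set (top_of_set (X - S)) x"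
  have comp: "C \<in> connected_components_of (subtopology ?T (X - S))"
    using x False by (simp add: C_def connected_component_in_connected_components_of
        subtopology_subtopology Int_absorb1)
  have xC: "x \<in> C"
    using x False by (simp add: C_def connected_component_of_refl)
  have CS: "C \<subseteq> X - S"
    using connected_components_of_subset[OF comp] by auto
  have conC: "connectedin ?T C"
    using connectedin_connected_components_of[OF comp] by (simp add: connectedin_subtopology)
  have "?T frontier_of C \<inter> ?T frontier_of (X - S) \<noteq> {}"
  proof (rule boundary_bumping_theorem[OF _ _ _ _ comp])
    show "connected_space ?T" "compact_space ?T" "Hausdorff_space ?T" "X - S \<subset> topspace ?T"
      using X S by (auto simp: continuum_def connected_space_subtopology
          compact_space_subtopology Hausdorff_space_subtopology connectedin_topspace)
  qed
  moreover have "?T frontier_of (X - S) \<subseteq> S"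
  proof -
    have "closedin ?T S"
      using S by (simp add: closed_subset finite_imp_closed)
    then have "?T frontier_of S \<subseteq> S"
      by (rule frontier_of_subset_closedin)
    then show ?thesis
      using frontier_of_complement[of ?T S] by simp
  qed
  ultimately obtain z where z: "z \<in> S" "z \<in> ?T closure_of C"
    by (auto simp: frontier_of_def)
  have "dist ((f ^^ k) x) ((f ^^ k) z) \<le> \<epsilon>" if k: "k < n" for k
  proof -
    have "connectedin ?T ((f ^^ k) ` C)"
      by (rule connectedin_continuous_map_image[OF cont[OF k] conC])
    moreover have "(f ^^ k) ` C \<inter> F = {}"
      using CS hits k by blast
    ultimately have "(f ^^ k) ` C \<subseteq> cball ((f ^^ k) x) \<epsilon>"
      using F xC by (fastforce simp: connectedin_subtopology)
    then have "closure ((f ^^ k) ` C) \<subseteq> cball ((f ^^ k) x) \<epsilon>"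
      by (simp add: closure_minimal)
    moreover have "(f ^^ k) z \<in> closure ((f ^^ k) ` C)"
      using continuous_map_image_closure_subset[OF cont[OF k], of C] z(2)
        closure_of_subtopology_subset[of euclidean X "(f ^^ k) ` C"] by auto
    ultimately show ?thesis by auto
  qed
  with z show ?thesis by blast
qed

lemma homeomorphic_map_funpow:
  assumes "homeomorphic_map T T f"
  shows "homeomorphic_map T T (f ^^ k)"
proof (induction k)
  case 0
  show ?case by (simp flip: id_def)
next
  case (Suc k)
  show ?case using homeomorphic_map_compose[OF Suc assms] by (simp only: funpow.simps)
qed

text \<open>
  The bound is linear because each single time \<open>k < n\<close> contributes at most \<open>card F\<close> points to the
  set of points whose orbit hits the cutting set \<open>F\<close>.
\<close>

lemma card_separated_set_linear_bound:
  assumes X: "regular_curve X"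
    and hom: "homeomorphic_map (top_of_set X) (top_of_set X) f"
    and "\<epsilon> > 0"
  shows "\<exists>K. \<forall>n\<ge>1. \<forall>E. separated_set X f n \<epsilon> E \<longrightarrow> card E \<le> n * K"
proof -
  \<comment> \<open>The estimate loses strictness in the closures, so the scale must be less than \<open>\<epsilon> / 2\<close>.\<close>
  obtain F where F: "finite F" "F \<noteq> {}" "F \<subseteq> X"
    "\<forall>C. connected C \<and> C \<subseteq> X \<and> C \<inter> F = {} \<longrightarrow> (\<forall>x\<in>C. \<forall>y\<in>C. dist x y < \<epsilon> / 3)"
    using regular_curve_cutting_set[OF X, of "\<epsilon> / 3"] \<open>\<epsilon> > 0\<close>
    by (metis zero_less_divide_iff zero_less_numeral)
  note homk = homeomorphic_map_funpow[OF hom]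
  have inj: "inj_on (f ^^ k) X" for k
    using homeomorphic_imp_injective_map[OF homk[of k]] by simp
  show ?thesis
  proof (intro exI allI impI)
    fix n E assume n: "n \<ge> 1" and E: "separated_set X f n \<epsilon> E"
    define P where "P k = X \<inter> (f ^^ k) -` F" for k
    define S where "S = (\<Union>k<n. P k)"
    have finP: "finite (P k)" for k
      using finite_vimage_IntI[OF F(1) inj[of k]] by (simp add: P_def Int_commute)
    have cardP: "card (P k) \<le> card F" for k
      by (rule card_inj_on_le[of "f ^^ k"])
        (use F(1) in \<open>auto simp: P_def intro: inj_on_subset[OF inj]\<close>)
    have "S \<noteq> {}"
    proof -
      have "P 0 \<noteq> {}" using F by (auto simp: P_def)
      then show ?thesis using n by (auto simp: S_def)
    qed
    have "card E \<le> card S"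
    proof (rule card_separated_set_le_spanning[OF n _ _ E])
      show "finite S" using finP by (simp add: S_def)
      fix x assume "x \<in> X"
      have "\<exists>z\<in>S. \<forall>k<n. dist ((f ^^ k) x) ((f ^^ k) z) \<le> \<epsilon> / 3"
      proof (rule hitting_set_spans)
        show "continuum X" using X by (simp add: regular_curve_def)
        show "\<And>k. continuous_map (top_of_set X) (top_of_set X) (f ^^ k)"
          by (rule homeomorphic_imp_continuous_map[OF homk])
        show "\<And>C x y. \<lbrakk>connected C; C \<subseteq> X; C \<inter> F = {}; x \<in> C; y \<in> C\<rbrakk> \<Longrightarrow> dist x y \<le> \<epsilon> / 3"
          using F(4) by (meson less_imp_le)
      qed (use \<open>\<epsilon> > 0\<close> \<open>S \<noteq> {}\<close> \<open>finite S\<close> \<open>x \<in> X\<close> in \<open>auto simp: S_def P_def\<close>)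
      moreover have "\<epsilon> / 3 < \<epsilon> / 2" using \<open>\<epsilon> > 0\<close> by simp
      ultimately show "\<exists>z\<in>S. \<forall>k<n. dist ((f ^^ k) x) ((f ^^ k) z) < \<epsilon> / 2"
        by (meson le_less_trans)
    qed
    also have "\<dots> \<le> (\<Sum>k<n. card (P k))"
      unfolding S_def by (rule card_UN_le) simp
    also have "\<dots> \<le> n * card F"
      using sum_bounded_above[of "{..<n}" "\<lambda>k. card (P k)" "card F"] cardP by simp
    finally show "card E \<le> n * card F" .
  qed
qed

section \<open>Separated backward orbits of a wandering point\<close>

lemma separated_backward_orbit:
  assumes hom: "homeomorphic_map (top_of_set X) (top_of_set X) f"
    and p: "p \<in> X" "wandering_point X f p"
  obtains \<delta> where "\<delta> > 0" "\<And>n. n \<ge> 1 \<Longrightarrow> \<exists>E. separated_set X f n \<delta> E \<and> card E = n"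
proof -
  obtain U where U: "p \<in> (top_of_set X) interior_of U" "wandering_set f U"
    using p by (auto simp: wandering_point_def)
  then obtain V where V: "openin (top_of_set X) V" "p \<in> V" "V \<subseteq> U"
    by (auto simp: interior_of_def)
  then obtain \<delta> where \<delta>: "\<delta> > 0" "ball p \<delta> \<inter> X \<subseteq> V"
    unfolding openin_contains_ball by blast
  note surj = homeomorphic_imp_surjective_map[OF homeomorphic_map_funpow[OF hom]]
  have mem: "(f ^^ k) x \<in> X" if "x \<in> X" for k x
    using surj[of k] that by auto
  have "\<exists>q\<in>X. (f ^^ k) q = p" for k
    using surj[of k] p(1) by (metis imageE topspace_euclidean_subtopology)
  then obtain q where q: "\<And>k. q k \<in> X" "\<And>k. (f ^^ k) (q k) = p"
    by metis
  have far: "\<delta> \<le> dist ((f ^^ j) (q i)) ((f ^^ j) (q j))" if "i < j" for i j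
  proof -
    have "(f ^^ j) (q i) = (f ^^ (j - i)) p"
      using that q(2)[of i] funpow_add[of "j - i" i f] by simp
    moreover have "(f ^^ (j - i)) p \<notin> U"
    proof -
      have "(f ^^ (j - i)) ` U \<inter> U = {}"
        using U(2) that by (simp add: wandering_set_def)
      then show ?thesis using V by blast
    qed
    ultimately have "(f ^^ j) (q i) \<notin> V"
      using V(3) by auto
    moreover have "(f ^^ j) (q i) \<in> X"
      by (rule mem[OF q(1)])
    ultimately have "(f ^^ j) (q i) \<notin> ball p \<delta>"
      using \<delta>(2) by blast
    then show ?thesis
      by (simp add: q(2) dist_commute)
  qed
  have inj: "inj q"
  proof (rule linorder_injI)
    fix i j :: nat assume "i < j"
    then show "q i \<noteq> q j" using far[of i j] \<delta>(1) by auto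
  qed
  show thesis
  proof (rule that[OF \<delta>(1)])
    fix n :: nat assume n: "n \<ge> 1"
    have "\<delta> \<le> bowen_dist f n (q i) (q j)" if "i < n" "j < n" "q i \<noteq> q j" for i j
    proof -
      consider "i < j" | "j < i" using \<open>q i \<noteq> q j\<close> by (metis nat_neq_iff)
      then show ?thesis
      proof cases
        case 1
        with far[of i j] that show ?thesis by (auto simp: bowen_dist_ge_iff[OF n])
      next
        case 2
        with far[of j i] that show ?thesis
          by (auto simp: bowen_dist_ge_iff[OF n] dist_commute)
      qed
    qed
    then have "separated_set X f n \<delta> (q ` {..<n})"
      using q(1) by (auto simp: separated_set_def)
    moreover have "card (q ` {..<n}) = n"
      using inj by (simp add: card_image inj_on_subset)
    ultimately show "\<exists>E. separated_set X f n \<delta> E \<and> card E = n" by blast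
  qed
qed

section \<open>Polynomial entropy\<close>

lemma limsup_log_ratio_linear_growth:
  fixes a :: "nat \<Rightarrow> nat"
  assumes lower: "\<And>n. n \<ge> 1 \<Longrightarrow> n \<le> a n" and upper: "\<And>n. n \<ge> 1 \<Longrightarrow> a n \<le> n * K"
  shows "limsup (\<lambda>n. ereal (ln (real (a n)) / ln (real n))) = 1"
proof -
  have "K > 0" using lower[of 1] upper[of 1] by simp
  have lower_ratio: "1 \<le> ln (real (a n)) / ln (real n)" if "n \<ge> 2" for n
    using lower[of n] that by simp
  have upper_ratio: "ln (real (a n)) / ln (real n) \<le> ln (real K) / ln (real n) + 1" if "n \<ge> 2" for n
  proof -
    have "real (a n) \<le> real n * real K"
      using upper[of n] that by (metis of_nat_le_iff of_nat_mult le_trans one_le_numeral)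
    then have "ln (real (a n)) \<le> ln (real n * real K)"
      using lower[of n] that by (subst ln_le_cancel_iff) auto
    then have "ln (real (a n)) \<le> ln (real n) + ln (real K)"
      using \<open>K > 0\<close> that by (simp add: ln_mult)
    then show ?thesis using that by (simp add: field_simps)
  qed
  have "filterlim (\<lambda>n. ln (real n)) at_top sequentially"
    using filterlim_compose[OF ln_at_top filterlim_real_sequentially] .
  then have "(\<lambda>n. ln (real K) / ln (real n)) \<longlonglongrightarrow> 0"
    by (rule real_tendsto_divide_at_top[OF tendsto_const])
  then have upper_lim: "(\<lambda>n. ln (real K) / ln (real n) + 1) \<longlonglongrightarrow> 1"
    using tendsto_add[OF _ tendsto_const, of _ 0 sequentially 1] by simp
  have "(\<lambda>n. ln (real (a n)) / ln (real n)) \<longlonglongrightarrow> 1"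
    by (rule tendsto_sandwich[OF _ _ tendsto_const upper_lim])
      (use lower_ratio upper_ratio in \<open>unfold eventually_sequentially, blast+\<close>)
  then have "(\<lambda>n. ereal (ln (real (a n)) / ln (real n))) \<longlonglongrightarrow> 1"
    by (simp add: one_ereal_def)
  then show ?thesis
    by (intro lim_imp_Limsup) auto
qed

theorem corollary5:
  fixes X :: "'a::metric_space set" and f :: "'a \<Rightarrow> 'a"
  assumes "regular_curve X"
    and "homeomorphic_map (top_of_set X) (top_of_set X) f"
    and "\<exists>p\<in>X. wandering_point X f p"
  shows "polynomial_entropy X f = 1"
proof -
  obtain \<delta> where \<delta>: "\<delta> > 0" "\<And>n. n \<ge> 1 \<Longrightarrow> \<exists>E. separated_set X f n \<delta> E \<and> card E = n"
    using assms(2,3) separated_backward_orbit by metis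
  let ?h = "\<lambda>\<epsilon>. limsup (\<lambda>n. ereal (ln (real (sep X f n \<epsilon>)) / ln (real n)))"
  have "?h \<epsilon> = 1" if \<epsilon>: "0 < \<epsilon>" "\<epsilon> < \<delta>" for \<epsilon>
  proof -
    obtain K where K: "\<And>n E. \<lbrakk>n \<ge> 1; separated_set X f n \<epsilon> E\<rbrakk> \<Longrightarrow> card E \<le> n * K"
      using card_separated_set_linear_bound[OF assms(1,2) \<epsilon>(1)] by blast
    show ?thesis
    proof (rule limsup_log_ratio_linear_growth)
      fix n :: nat assume n: "n \<ge> 1"
      show "sep X f n \<epsilon> \<le> n * K"
        by (rule sep_le) (rule K[OF n])
      obtain E where "separated_set X f n \<delta> E" "card E = n"
        using \<delta>(2)[OF n] by blast
      then show "n \<le> sep X f n \<epsilon>"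
        using card_le_sep[OF K[OF n]] separated_set_antimono[of X f n \<delta> E \<epsilon>] \<epsilon> by fastforce
    qed
  qed
  then have "eventually (\<lambda>\<epsilon>. ?h \<epsilon> = 1) (at_right 0)"
    using \<delta>(1) unfolding eventually_at_right_field by blast
  then have "(?h \<longlongrightarrow> 1) (at_right 0)"
    by (rule tendsto_eventually)
  then show ?thesis
    unfolding polynomial_entropy_def by (intro tendsto_Lim) simp_all
qed

end
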